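(* Consider tuples $(P,K,Q,Y,\{\alpha_i\}_{i=0,\ldots,T-1},\beta,\gamma)$ and the Problems (NC) and (R$_{\tilde P}$) defined in the context, where $\tilde P\in\mathbb{S}^{n_x}_{++}$. (1) For every $\tilde P\in\mathbb{S}^{n_x}_{++}$, any feasible solution $(P,K,Q,Y,\{\alpha_i\}_{i=0,\ldots,T-1},\beta,\gamma)$ to Problem (R$_{\tilde P}$) is also feasible for Problem (NC). (2) Given a feasible solution $(P,K,Q,Y,\{\alpha_i\}_{i=0,\ldots,T-1},\beta,\gamma)$ to Problem (NC), take $\tilde P=P$; then $(P,K,Q,Y,\{\alpha_i\}_{i=0,\ldots,T-1},\beta,\gamma)$ is also feasible for Problem (R$_{\tilde P}$).
   Context: $\mathbb{S}^{n}_{++}$ denotes the set of real symmetric positive definite $n\times n$ matrices; $\succ,\succeq,\preceq$ denote the Loewner order; $\circ$ is the elementwise product. Fixed matrices: $C\in\mathbb{R}^{n_y\times n_x}$, $D\in\mathbb{R}^{n_y\times n_u}$, $G\in\mathbb{R}^{n_x\times n_d}$. A sparsity pattern is given by a binary matrix $I_S\in\{0,1\}^{n_u\times n_x}$, and $I_{S^c}=\mathbf{1}-I_S$ where $\mathbf{1}$ is the all-ones matrix. Data: a positive integer $T$, states $x_0,\ldots,x_T\in\mathbb{R}^{n_x}$ and inputs $u_0,\ldots,u_{T-1}\in\mathbb{R}^{n_u}$ are given, generated by $x_{k+1}=A_*x_k+B_*u_k+w_k$ with unknown matrices $A_*,B_*$ and unknown noise satisfying $\|w_k\|_2\le\epsilon$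 for $k=0,\ldots,T-1$, where $\epsilon>0$ is known. For $i=0,\ldots,T-1$ define the symmetric matrix of size $2n_x+n_u$ $$\Psi_i=\begin{bmatrix} I & x_{i+1}\\ 0&-x_i\\ 0&-u_i\end{bmatrix}\begin{bmatrix}\epsilon^2 I&0\\0&-1\end{bmatrix}\begin{bmatrix} I & x_{i+1}\\ 0&-x_i\\ 0&-u_i\end{bmatrix}^\top .$$ Problem (NC): minimize $\gamma$ over $P,K,Q,Y,\{\alpha_i\}_{i=0,\ldots,T-1},\beta,\gamma$ (with $K\in\mathbb{R}^{n_u\times n_x}$ and $\alpha_i,\beta,\gamma$ real scalars) subject to (a) $\begin{bmatrix} P-GG^\top-\beta I&0&0&0\\0&0&0&I\\0&0&0&K\\0&I&K^\top&Y\end{bmatrix}-\begin{bmatrix}\sum_{i=0}^{T-1}\alpha_i\Psi_i&0\\0&0\end{bmatrix}\succeq0$, where the row/column blocks of the first matrix have sizes $n_x,n_x,n_u,n_x$ and the second matrix is partitioned with blocks of sizes $2n_x+n_u$ and $n_x$; (b) $\begin{bmatrix}Q&C+DK\\(C+DK)^\top&Y\end{bmatrix}\succ0$, $\operatorname{Tr}(Q)\le\gamma^2$, $K\circ I_{S^c}=0$; (c) $Y\preceq P^{-1}$; (d) $\alpha_0\ge0,\ldots,\alpha_{T-1}\ge0$, $\beta>0$; (e) $P\in\mathbb{S}^{n_x}_{++}$, $Q\in\mathbb{S}^{n_y}_{++}$, $Y\in\mathbb{S}^{n_x}_{++}$. Problem (R$_{\tilde P}$): the same problem with constraints (a), (b),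 (d), (e), and with (c) replaced by $$Y\preceq\tilde P^{-1}-\tilde P^{-1}(P-\tilde P)\tilde P^{-1}.$$ *)

theory Defs
  imports "HOL-Analysis.Analysis"
begin

text \<open>
  Block matrices are matrices whose row and column index types are sums of finite types.
\<close>

definition hcat :: "'a^'n^'m \<Rightarrow> 'a^'p^'m \<Rightarrow> 'a^('n + 'p)^'m"  (infixr "|||" 62) where
  "A ||| B = (\<chi> i j. case j of Inl k \<Rightarrow> A $ i $ k | Inr k \<Rightarrow> B $ i $ k)"

definition vcat :: "'a^'n^'m \<Rightarrow> 'a^'n^'q \<Rightarrow> 'a^'n^('m + 'q)"  (infixr "'/'/'/" 61) where
  "A /// B = (\<chi> i. case i of Inl k \<Rightarrow> A $ k | Inr k \<Rightarrow> B $ k)"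

definition pos_semidef :: "real^'n^'n \<Rightarrow> bool" where
  "pos_semidef A \<longleftrightarrow> transpose A = A \<and> (\<forall>v. v \<bullet> (A *v v) \<ge> 0)"

definition pos_def :: "real^'n^'n \<Rightarrow> bool" where
  "pos_def A \<longleftrightarrow> transpose A = A \<and> (\<forall>v. v \<noteq> 0 \<longrightarrow> v \<bullet> (A *v v) > 0)"

definition loewner_le :: "real^'n^'n \<Rightarrow> real^'n^'n \<Rightarrow> bool"  (infix "\<preceq>" 50) where
  "A \<preceq> B \<longleftrightarrow> pos_semidef (B - A)"

definition data_factor ::
    "(nat \<Rightarrow> real^'nx) \<Rightarrow> (nat \<Rightarrow> real^'nu) \<Rightarrow> nat \<Rightarrow> real^('nx + 1)^('nx + 'nx + 'nu)" where
  "data_factor x u i =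
     (mat 1 |||   columnvector (x (i + 1))) ///
     (0     ||| - columnvector (x i)) ///
     (0     ||| - columnvector (u i))"

definition Psi ::
    "(nat \<Rightarrow> real^'nx) \<Rightarrow> (nat \<Rightarrow> real^'nu) \<Rightarrow> real \<Rightarrow> nat
     \<Rightarrow> real^('nx + 'nx + 'nu)^('nx + 'nx + 'nu)" where
  "Psi x u \<epsilon> i =
     data_factor x u i ** ((mat (\<epsilon>\<^sup>2) ||| 0) /// (0 ||| mat (-1))) ** transpose (data_factor x u i)"

text \<open>
  The parentheses group the first three block rows and columns of the first matrix, so that
  its index type agrees with that of the second one, whose blocks
  have sizes \<open>2 n\<^sub>x + n\<^sub>u\<close> and \<open>n\<^sub>x\<close>.
\<close>

definition lmi_matrix ::
    "real^'nd^'nx \<Rightarrow> nat \<Rightarrow> (nat \<Rightarrow> real^'nx) \<Rightarrow> (nat \<Rightarrow> real^'nu) \<Rightarrow> real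
     \<Rightarrow> real^'nx^'nx \<Rightarrow> real^'nx^'nu \<Rightarrow> real^'nx^'nx \<Rightarrow> (nat \<Rightarrow> real) \<Rightarrow> real
     \<Rightarrow> real^(('nx + 'nx + 'nu) + 'nx)^(('nx + 'nx + 'nu) + 'nx)" where
  "lmi_matrix G T x u \<epsilon> P K Y \<alpha> \<beta> =
     (((((P - G ** transpose G - mat \<beta>) ||| 0     ||| 0          ) ||| 0    ) ///
       ((0                              ||| 0     ||| 0          ) ||| mat 1) ///
       ((0                              ||| 0     ||| 0          ) ||| K    )) ///
       ((0                              ||| mat 1 ||| transpose K) ||| Y    ))
     - (((\<Sum>i<T. \<alpha> i *\<^sub>R Psi x u \<epsilon> i) ||| 0) ///
        (0                             ||| 0))"

text \<open>
  The constraints shared by the nonconvex problem and its restriction, which differ only in the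
  upper bound on \<open>Y\<close>. On matrices, the multiplication \<open>*\<close> is the elementwise product and \<open>1\<close>
  is the all-ones matrix (the identity is \<open>mat 1\<close> and the matrix product is \<open>**\<close>), so
  \<open>K * (1 - I\<^sub>S) = 0\<close> is the sparsity constraint. Only the values of \<open>\<alpha>\<close> below \<open>T\<close> matter.
\<close>

definition common_constraints ::
    "real^'nx^'ny \<Rightarrow> real^'nu^'ny \<Rightarrow> real^'nd^'nx \<Rightarrow> real^'nx^'nu
     \<Rightarrow> nat \<Rightarrow> (nat \<Rightarrow> real^'nx) \<Rightarrow> (nat \<Rightarrow> real^'nu) \<Rightarrow> real
     \<Rightarrow> real^'nx^'nx \<Rightarrow> real^'nx^'nu \<Rightarrow> real^'ny^'ny \<Rightarrow> real^'nx^'nx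
     \<Rightarrow> (nat \<Rightarrow> real) \<Rightarrow> real \<Rightarrow> real \<Rightarrow> bool" where
  "common_constraints C D G I\<^sub>S T x u \<epsilon> P K Q Y \<alpha> \<beta> \<gamma> \<longleftrightarrow>
     pos_semidef (lmi_matrix G T x u \<epsilon> P K Y \<alpha> \<beta>) \<and>
     pos_def ((Q                      ||| (C + D ** K)) ///
              (transpose (C + D ** K) ||| Y           )) \<and>
     trace Q \<le> \<gamma>\<^sup>2 \<and>
     K * (1 - I\<^sub>S) = 0 \<and>
     (\<forall>i<T. \<alpha> i \<ge> 0) \<and> \<beta> > 0 \<and>
     pos_def P \<and> pos_def Q \<and> pos_def Y"

definition feasible_NC ::
    "real^'nx^'ny \<Rightarrow> real^'nu^'ny \<Rightarrow> real^'nd^'nx \<Rightarrow> real^'nx^'nu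
     \<Rightarrow> nat \<Rightarrow> (nat \<Rightarrow> real^'nx) \<Rightarrow> (nat \<Rightarrow> real^'nu) \<Rightarrow> real
     \<Rightarrow> real^'nx^'nx \<Rightarrow> real^'nx^'nu \<Rightarrow> real^'ny^'ny \<Rightarrow> real^'nx^'nx
     \<Rightarrow> (nat \<Rightarrow> real) \<Rightarrow> real \<Rightarrow> real \<Rightarrow> bool" where
  "feasible_NC C D G I\<^sub>S T x u \<epsilon> P K Q Y \<alpha> \<beta> \<gamma> \<longleftrightarrow>
     common_constraints C D G I\<^sub>S T x u \<epsilon> P K Q Y \<alpha> \<beta> \<gamma> \<and>
     Y \<preceq> matrix_inv P"

definition feasible_R ::
    "real^'nx^'ny \<Rightarrow> real^'nu^'ny \<Rightarrow> real^'nd^'nx \<Rightarrow> real^'nx^'nu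
     \<Rightarrow> nat \<Rightarrow> (nat \<Rightarrow> real^'nx) \<Rightarrow> (nat \<Rightarrow> real^'nu) \<Rightarrow> real
     \<Rightarrow> real^'nx^'nx
     \<Rightarrow> real^'nx^'nx \<Rightarrow> real^'nx^'nu \<Rightarrow> real^'ny^'ny \<Rightarrow> real^'nx^'nx
     \<Rightarrow> (nat \<Rightarrow> real) \<Rightarrow> real \<Rightarrow> real \<Rightarrow> bool" where
  "feasible_R C D G I\<^sub>S T x u \<epsilon> P' P K Q Y \<alpha> \<beta> \<gamma> \<longleftrightarrow>
     common_constraints C D G I\<^sub>S T x u \<epsilon> P K Q Y \<alpha> \<beta> \<gamma> \<and>
     Y \<preceq> matrix_inv P' - matrix_inv P' ** (P - P') ** matrix_inv P'"

end

theory Submission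
  imports Defs
begin

text \<open>
  The two problems differ only in the upper bound on \<open>Y\<close>, so everything is about comparing these
  bounds. The bound of the restriction is the first-order Taylor expansion of the matrix inverse
  around \<open>P'\<close>. Since inversion is convex in the Loewner order, the expansion lies below the
  inverse, which gives the first claim by transitivity; at \<open>P' = P\<close> it is exact, which gives the
  second. Convexity needs no calculus here: with \<open>R\<close> and \<open>S\<close> the inverses of \<open>P\<close> and \<open>P'\<close>, the gap
  between the inverse and its expansion is the congruence \<open>(R - S) ** P ** (R - S)\<close>, an expression
  that is visibly positive semidefinite (\<open>matrix_inv_tangent_gap\<close>).
\<close>

lemma pos_def_imp_pos_semidef: "pos_def A \<Longrightarrow> pos_semidef A"
  unfolding pos_def_def pos_semidef_def by (metis inner_zero_left order_less_imp_le order_refl)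

lemma pos_semidef_add:
  assumes "pos_semidef A" "pos_semidef B"
  shows "pos_semidef (A + B)"
proof -
  have "transpose (A + B) = transpose A + transpose B"
    by (simp add: transpose_def vec_eq_iff)
  then show ?thesis
    using assms by (simp add: pos_semidef_def matrix_vector_mult_add_rdistrib inner_add_right)
qed

lemma loewner_le_trans:
  assumes "A \<preceq> B" "B \<preceq> E"
  shows "A \<preceq> E"
  using pos_semidef_add[of "B - A" "E - B"] assms by (simp add: loewner_le_def)

lemma pos_semidef_congruence:
  assumes "pos_semidef A"
  shows "pos_semidef (transpose M ** A ** M)"
  unfolding pos_semidef_def
proof (intro conjI allI)
  show "transpose (transpose M ** A ** M) = transpose M ** A ** M"
    using assms by (simp add: pos_semidef_def matrix_transpose_mul matrix_mul_assoc)
  show "v \<bullet> ((transpose M ** A ** M) *v v) \<ge> 0" for v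
  proof -
    have "v \<bullet> ((transpose M ** A ** M) *v v) = (A *v (M *v v)) \<bullet> (M *v v)"
      by (simp add: dot_lmul_matrix inner_commute[of v] flip: matrix_vector_mul_assoc)
    then show ?thesis
      using assms by (simp add: pos_semidef_def inner_commute)
  qed
qed

text \<open>A vector in the kernel has a vanishing quadratic form, so the kernel is trivial.\<close>

lemma pos_def_invertible:
  assumes "pos_def A"
  shows "invertible A"
proof -
  have "v = 0" if "A *v v = 0" for v
    using assms that by (metis inner_zero_right less_irrefl pos_def_def)
  then show ?thesis
    by (simp add: invertible_left_inverse matrix_left_invertible_ker)
qed

lemma matrix_inv_inverse:
  fixes A :: "real^'n^'n"
  assumes "invertible A"
  shows "A ** matrix_inv A = mat 1" "matrix_inv A ** A = mat 1"
  using assms unfolding invertible_def matrix_inv_def by (metis (lifting) someI_ex)+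

lemma transpose_matrix_inv_symmetric:
  fixes A :: "real^'n^'n"
  assumes "invertible A" "transpose A = A"
  shows "transpose (matrix_inv A) = matrix_inv A"
proof -
  let ?R = "matrix_inv A"
  have "transpose ?R ** A = mat 1"
    by (metis assms matrix_inv_inverse(1) matrix_transpose_mul transpose_mat)
  then have "transpose ?R = transpose ?R ** (A ** ?R)" and "transpose ?R ** A ** ?R = ?R"
    using assms(1) by (simp_all add: matrix_inv_inverse)
  then show ?thesis
    by (simp add: matrix_mul_assoc)
qed

lemma matrix_diff_ldistrib:
  fixes A :: "'a::ring_1^'n^'m"
  shows "A ** (B - E) = A ** B - A ** E"
  by (simp add: matrix_matrix_mult_def vec_eq_iff right_diff_distrib sum_subtractf)

lemma matrix_diff_rdistrib:
  fixes A :: "'a::ring_1^'n^'m"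
  shows "(A - B) ** E = A ** E - B ** E"
  by (simp add: matrix_matrix_mult_def vec_eq_iff left_diff_distrib sum_subtractf)

text \<open>
  The matrix form of the scalar identity \<open>1/a - (1/b - (a - b)/b\<^sup>2) = a (1/a - 1/b)\<^sup>2\<close>, with the
  factors ordered so that they need not commute.
\<close>

lemma matrix_inv_tangent_gap:
  fixes A B :: "real^'n^'n"
  assumes "invertible A" "invertible B"
  shows "matrix_inv A - (matrix_inv B - matrix_inv B ** (A - B) ** matrix_inv B)
       = (matrix_inv A - matrix_inv B) ** A ** (matrix_inv A - matrix_inv B)"
proof -
  let ?R = "matrix_inv A" and ?S = "matrix_inv B"
  have "(?R - ?S) ** A ** (?R - ?S) = (mat 1 - ?S ** A) ** (?R - ?S)"
    using assms by (simp add: matrix_diff_rdistrib matrix_inv_inverse)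
  also have "\<dots> = ?R - ?S - (?S - ?S ** A ** ?S)"
    using assms by (simp add: matrix_diff_rdistrib matrix_diff_ldistrib matrix_inv_inverse
        flip: matrix_mul_assoc)
  also have "?S - ?S ** A ** ?S = - (?S ** (A - B) ** ?S)"
    using assms by (simp add: matrix_diff_rdistrib matrix_diff_ldistrib matrix_inv_inverse)
  finally show ?thesis
    by simp
qed

text \<open>
  The difference of the inverses is symmetric, which is what makes the gap a congruence of \<open>A\<close>.
  In terms of convexity: on positive definite matrices, inversion lies above its tangent at \<open>B\<close>.
\<close>

lemma matrix_inv_tangent_le:
  assumes "pos_def A" "pos_def B"
  shows "matrix_inv B - matrix_inv B ** (A - B) ** matrix_inv B \<preceq> matrix_inv A"
proof -
  let ?N = "matrix_inv A - matrix_inv B"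
  have inv: "invertible A" "invertible B"
    using assms by (simp_all add: pos_def_invertible)
  have "transpose ?N = transpose (matrix_inv A) - transpose (matrix_inv B)"
    by (simp add: transpose_def vec_eq_iff)
  then have "transpose ?N = ?N"
    using assms inv by (simp add: transpose_matrix_inv_symmetric pos_def_def)
  then have "pos_semidef (?N ** A ** ?N)"
    using pos_semidef_congruence[of A ?N] assms(1) by (simp add: pos_def_imp_pos_semidef)
  then show ?thesis
    by (simp add: loewner_le_def matrix_inv_tangent_gap[OF inv])
qed

theorem theorem1:
  fixes C :: "real^'nx^'ny" and D :: "real^'nu^'ny" and G :: "real^'nd^'nx"
    and I\<^sub>S :: "real^'nx^'nu"
    and T :: nat and x :: "nat \<Rightarrow> real^'nx" and u :: "nat \<Rightarrow> real^'nu"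
    and w :: "nat \<Rightarrow> real^'nx" and \<epsilon> :: real
    and A_true :: "real^'nx^'nx" and B_true :: "real^'nu^'nx"
  assumes binary: "\<forall>i j. I\<^sub>S $ i $ j \<in> {0, 1}"
    and T_pos: "T > 0"
    and eps_pos: "\<epsilon> > 0"
    and dynamics: "\<forall>k<T. x (k + 1) = A_true *v x k + B_true *v u k + w k"
    and noise: "\<forall>k<T. norm (w k) \<le> \<epsilon>"
  shows "(\<forall>P'. pos_def P' \<longrightarrow>
            (\<forall>P K Q Y \<alpha> \<beta> \<gamma>.
               feasible_R C D G I\<^sub>S T x u \<epsilon> P' P K Q Y \<alpha> \<beta> \<gamma> \<longrightarrow>
               feasible_NC C D G I\<^sub>S T x u \<epsilon> P K Q Y \<alpha> \<beta> \<gamma>))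
       \<and> (\<forall>P K Q Y \<alpha> \<beta> \<gamma>.
            feasible_NC C D G I\<^sub>S T x u \<epsilon> P K Q Y \<alpha> \<beta> \<gamma> \<longrightarrow>
            feasible_R C D G I\<^sub>S T x u \<epsilon> P P K Q Y \<alpha> \<beta> \<gamma>)"
proof (intro conjI allI impI)
  fix P' P K Q Y \<alpha> \<beta> \<gamma>
  assume "pos_def P'" and "feasible_R C D G I\<^sub>S T x u \<epsilon> P' P K Q Y \<alpha> \<beta> \<gamma>"
  then show "feasible_NC C D G I\<^sub>S T x u \<epsilon> P K Q Y \<alpha> \<beta> \<gamma>"
    by (auto simp: feasible_R_def feasible_NC_def common_constraints_def
        intro: loewner_le_trans matrix_inv_tangent_le)
next
  fix P K Q Y \<alpha> \<beta> \<gamma>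
  assume "feasible_NC C D G I\<^sub>S T x u \<epsilon> P K Q Y \<alpha> \<beta> \<gamma>"
  then show "feasible_R C D G I\<^sub>S T x u \<epsilon> P P K Q Y \<alpha> \<beta> \<gamma>"
    by (simp add: feasible_R_def feasible_NC_def)
qed

end
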